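(* Let $\mathcal{S}$ be a compact convex subset of a Euclidean space with $2$-dimensional affine hull, $\mathrm{Aff}(\mathcal{S}) = \mathbb{R}^2$. Then the group of bijective affine transformations of $\mathcal{S}$ (onto itself) acts transitively on the set $\mathcal{S}_{\mathrm{ext}}$ of extreme points of $\mathcal{S}$ if and only if $\mathcal{S}$ is affine isomorphic to one of the following two kinds of objects: (1) a symmetric (i.e. vertex-transitive) convex polygon; (2) the ($2$-dimensional) unit disk.
   Context: A group $G$ acts transitively on a set $X$ if for any $x_1,x_2\in X$ there is $g\in G$ with $g\cdot x_1=x_2$. A convex polytope (in particular a convex polygon) is called symmetric, or vertex-transitive, if the group of affine isometries mapping it onto itself acts transitively on its set of vertices. Two convex sets are affine isomorphic if there is an affine bijection between them. The unit disk is the closed solid disk $\{(x,y)\in\mathbb{R}^2 \mid x^2+y^2\le 1\}$. *)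

theory Defs
  imports "HOL-Analysis.Analysis" "HOL-Algebra.Group_Action"
begin

text \<open>
  The domain is intended to be convex. On an affine subspace, and in particular on \<open>UNIV\<close>,
  preserving convex combinations already forces preserving all affine combinations.
\<close>

definition affine_map_on :: "'a::real_vector set \<Rightarrow> ('a \<Rightarrow> 'b::real_vector) \<Rightarrow> bool" where
  "affine_map_on S f \<longleftrightarrow>
     (\<forall>x\<in>S. \<forall>y\<in>S. \<forall>u\<in>{0..1}. f ((1 - u) *\<^sub>R x + u *\<^sub>R y) = (1 - u) *\<^sub>R f x + u *\<^sub>R f y)"

definition affine_isomorphic :: "'a::real_vector set \<Rightarrow> 'b::real_vector set \<Rightarrow> bool" where
  "affine_isomorphic S T \<longleftrightarrow> (\<exists>f. affine_map_on S f \<and> bij_betw f S T)"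

definition affine_aut_group :: "'a::real_vector set \<Rightarrow> ('a \<Rightarrow> 'a) monoid" where
  "affine_aut_group S = BijGroup S \<lparr>carrier := {f \<in> Bij S. affine_map_on S f}\<rparr>"

definition affine_isometry_group :: "'a::euclidean_space set \<Rightarrow> ('a \<Rightarrow> 'a) monoid" where
  "affine_isometry_group P = BijGroup UNIV
     \<lparr>carrier := {f \<in> Bij UNIV. affine_map_on UNIV f \<and> (\<forall>x y. dist (f x) (f y) = dist x y) \<and> f ` P = P}\<rparr>"

definition extreme_points :: "'a::real_vector set \<Rightarrow> 'a set" where
  "extreme_points S = {x. x extreme_point_of S}"

text \<open>
  The evaluation action of a group of self-maps on \<open>X\<close>. The restriction is needed because the
  elements of \<^term>\<open>BijGroup X\<close> are extensional functions on \<open>X\<close>.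
\<close>

abbreviation acts_transitively_on :: "('a \<Rightarrow> 'a) monoid \<Rightarrow> 'a set \<Rightarrow> bool" where
  "acts_transitively_on G X \<equiv> transitive_action G X (\<lambda>g. restrict g X)"

definition vertex_transitive_polytope :: "'a::euclidean_space set \<Rightarrow> bool" where
  "vertex_transitive_polytope P \<longleftrightarrow>
     polytope P \<and> acts_transitively_on (affine_isometry_group P) (extreme_points P)"

definition symmetric_convex_polygon :: "(real^2) set \<Rightarrow> bool" where
  "symmetric_convex_polygon P \<longleftrightarrow> vertex_transitive_polytope P \<and> aff_dim P = 2"

definition unit_disk :: "(real^2) set" where
  "unit_disk = {p. (p $ 1)\<^sup>2 + (p $ 2)\<^sup>2 \<le> 1}"

end

theory Submission
  imports Defs
begin

text \<open>
  An affine bijection of a planar convex body \<open>S\<close> fixes its centroid and has determinant \<open>\<plusminus>1\<close>, so it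
  preserves the quadratic form of second moments. In coordinates that turn this form into
  the Euclidean norm, every affine automorphism is an orthogonal map, and transitivity puts all
  extreme points on one circle. If they are finitely many, the body is a symmetric polygon. If not,
  three close extreme points yield a rotation by an arbitrarily small angle (one of the two
  isometries moving the first point to the others, or their composition when both are reflections),
  so the extreme points are dense in the circle and the body is a disk.
\<close>

section \<open>Affine maps and transitivity on extreme points\<close>

text \<open>Automorphisms are only assumed to respect convex combinations of points of
  \<open>S\<close>. Comparing values along rays from an interior point shows that they extend to
  linear maps up to translation; this is why the body is first moved out of its ambient space into
  \<open>real^2\<close>, where its interior is nonempty. A form of second moments naturally takes
  linear functionals as arguments. Pairing vectors by signed area lets it take vectors instead, and
  maps of determinant \<plusminus>1 respect this pairing up to sign, so no inverse transpose
  appears. Two copies of the plane are in use: \<open>real^2\<close> for determinants and change of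
  variables, \<open>complex\<close> for orthogonal maps, which become multiplication by a unit
  number, possibly after conjugation. The group actions of the statement enter only through the
  existence of one suitable map for each pair of extreme points, a property that conjugation carries
  along affine isomorphisms; this also settles the converse.\<close>

definition affine_transitive :: "'a::real_vector set \<Rightarrow> bool" where
  "affine_transitive S \<longleftrightarrow>
     (\<forall>x\<in>extreme_points S. \<forall>y\<in>extreme_points S. \<exists>f. affine_map_on S f \<and> bij_betw f S S \<and> f x = y)"

lemma affine_map_onD:
  "\<lbrakk>affine_map_on S f; x \<in> S; y \<in> S; 0 \<le> u; u \<le> 1\<rbrakk> \<Longrightarrow>
     f ((1 - u) *\<^sub>R x + u *\<^sub>R y) = (1 - u) *\<^sub>R f x + u *\<^sub>R f y"
  by (simp add: affine_map_on_def)

lemma affine_map_on_subset: "affine_map_on T f \<Longrightarrow> S \<subseteq> T \<Longrightarrow> affine_map_on S f"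
  by (auto simp: affine_map_on_def)

lemma affine_map_on_linear: "linear L \<Longrightarrow> affine_map_on S (\<lambda>x. L (x - a) + b)"
  unfolding affine_map_on_def
  by (auto simp: linear_add linear_diff linear_scale algebra_simps)

text \<open>The defining equation also evaluates the maps at convex combinations, hence convexity.
  It serves to pass to the extensional restrictions that make up \<open>Bij S\<close>.\<close>

lemma affine_map_on_cong:
  assumes "convex S" "\<And>x. x \<in> S \<Longrightarrow> f x = g x"
  shows "affine_map_on S f \<longleftrightarrow> affine_map_on S g"
  using assms unfolding affine_map_on_def convex_alt by auto

lemma affine_map_on_comp:
  assumes "affine_map_on S f" "affine_map_on T g" "f ` S \<subseteq> T"
  shows "affine_map_on S (g \<circ> f)"
  using assms unfolding affine_map_on_def by (auto simp: image_subset_iff)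

lemma affine_map_on_inv:
  assumes "affine_map_on S f" "bij_betw f S T" "convex S"
  shows "affine_map_on T (inv_into S f)"
  unfolding affine_map_on_def
proof (intro ballI)
  fix x y u :: _ assume x: "x \<in> T" and y: "y \<in> T" and u: "u \<in> {0..1::real}"
  let ?g = "inv_into S f"
  have g: "?g x \<in> S" "?g y \<in> S"
    using assms(2) x y by (auto simp: bij_betw_def inv_into_into)
  then have "(1 - u) *\<^sub>R ?g x + u *\<^sub>R ?g y \<in> S"
    using assms(3) u by (auto simp: convex_alt)
  moreover have "f ((1 - u) *\<^sub>R ?g x + u *\<^sub>R ?g y) = (1 - u) *\<^sub>R x + u *\<^sub>R y"
    using affine_map_onD[OF assms(1) g, of u] u x y assms(2)
    by (simp add: bij_betw_inv_into_right)
  ultimately show "?g ((1 - u) *\<^sub>R x + u *\<^sub>R y) = (1 - u) *\<^sub>R ?g x + u *\<^sub>R ?g y"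
    by (metis assms(2) bij_betw_inv_into_left)
qed

lemma affine_isomorphic_sym:
  "affine_isomorphic S T \<Longrightarrow> convex S \<Longrightarrow> affine_isomorphic T S"
  unfolding affine_isomorphic_def by (meson affine_map_on_inv bij_betw_inv_into)

lemma affine_isomorphic_trans:
  assumes "affine_isomorphic S T" "affine_isomorphic T U"
  shows "affine_isomorphic S U"
  using assms unfolding affine_isomorphic_def
  by (metis affine_map_on_comp bij_betw_def bij_betw_trans order_refl)

lemma affine_isomorphic_linear:
  assumes "linear L" "inj_on L ((\<lambda>x. x - a) ` S)"
  shows "affine_isomorphic S ((\<lambda>x. L (x - a) + b) ` S)"
  unfolding affine_isomorphic_def
  by (rule exI[where x="\<lambda>x. L (x - a) + b"])
     (use assms in \<open>auto simp: affine_map_on_linear bij_betw_def inj_on_def\<close>)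

lemma convex_affine_map_image:
  assumes "convex S" "affine_map_on S f"
  shows "convex (f ` S)"
  unfolding convex_alt
proof clarify
  fix x y u assume *: "x \<in> S" "y \<in> S" "0 \<le> u" "u \<le> (1::real)"
  then have "(1 - u) *\<^sub>R x + u *\<^sub>R y \<in> S"
    using \<open>convex S\<close> by (simp add: convex_alt)
  then show "(1 - u) *\<^sub>R f x + u *\<^sub>R f y \<in> f ` S"
    using affine_map_onD[OF assms(2) *] by force
qed

text \<open>The inverse is affine as well, so a segment with \<open>f x\<close> in its relative
  interior would pull back to one with \<open>x\<close> in its relative interior.\<close>

lemma extreme_points_affine_bij:
  assumes f: "affine_map_on S f" "bij_betw f S T" and "convex S" and x: "x \<in> extreme_points S"
  shows "f x \<in> extreme_points T"
proof -
  have xS: "x \<in> S" and ext: "\<And>a b. a \<in> S \<Longrightarrow> b \<in> S \<Longrightarrow> x \<notin> open_segment a b"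
    using x by (auto simp: extreme_points_def extreme_point_of_def)
  have "f x \<notin> open_segment c d" if "c \<in> T" "d \<in> T" for c d
  proof
    assume "f x \<in> open_segment c d"
    then obtain u where u: "0 < u" "u < 1" "c \<noteq> d" "f x = (1 - u) *\<^sub>R c + u *\<^sub>R d"
      by (auto simp: in_segment)
    let ?g = "inv_into S f"
    have "?g (f x) = (1 - u) *\<^sub>R ?g c + u *\<^sub>R ?g d"
      using affine_map_onD[OF affine_map_on_inv[OF f \<open>convex S\<close>] that, of u] u by simp
    then have "x = (1 - u) *\<^sub>R ?g c + u *\<^sub>R ?g d"
      using xS f(2) by (simp add: bij_betw_inv_into_left)
    moreover have "?g c \<noteq> ?g d" "?g c \<in> S" "?g d \<in> S"
      using that u(3) f(2) by (metis bij_betw_inv_into_right, auto simp: bij_betw_def inv_into_into)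
    ultimately show False
      using ext u(1,2) unfolding in_segment by blast
  qed
  then show ?thesis
    using xS f(2) by (auto simp: extreme_points_def extreme_point_of_def bij_betw_def)
qed

lemma bij_betw_extreme_points:
  assumes f: "affine_map_on S f" "bij_betw f S T" and "convex S"
  shows "bij_betw f (extreme_points S) (extreme_points T)"
proof -
  have sub: "extreme_points U \<subseteq> U" for U :: "'c::real_vector set"
    by (auto simp: extreme_points_def extreme_point_of_def)
  have T: "convex T"
    using convex_affine_map_image[OF \<open>convex S\<close> f(1)] f(2) by (simp add: bij_betw_def)
  have "y \<in> f ` extreme_points S" if y: "y \<in> extreme_points T" for y
  proof
    show "inv_into S f y \<in> extreme_points S"
      using extreme_points_affine_bij[OF affine_map_on_inv[OF f \<open>convex S\<close>] bij_betw_inv_into[OF f(2)] T y] .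
    show "y = f (inv_into S f y)"
      using y sub f(2) by (metis bij_betw_inv_into_right subsetD)
  qed
  moreover have "inj_on f (extreme_points S)"
    using f(2) sub by (meson bij_betw_def inj_on_subset)
  ultimately show ?thesis
    using extreme_points_affine_bij[OF f \<open>convex S\<close>] by (auto simp: bij_betw_def)
qed

text \<open>Conjugate an automorphism of \<open>S\<close> with the isomorphism. This moves the
  hypothesis to a convenient model of the body and, for the converse, brings transitivity back from
  the polygon or the disk.\<close>

lemma affine_transitive_isomorphic:
  assumes "affine_isomorphic S T" "convex S" "affine_transitive S"
  shows "affine_transitive T"
proof -
  obtain h where h: "affine_map_on S h" "bij_betw h S T"
    using assms(1) by (auto simp: affine_isomorphic_def)
  let ?k = "inv_into S h"
  have k: "affine_map_on T ?k" "bij_betw ?k T S"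
    using h \<open>convex S\<close> by (simp_all add: affine_map_on_inv bij_betw_inv_into)
  have sub: "extreme_points T \<subseteq> T"
    by (auto simp: extreme_points_def extreme_point_of_def)
  have T: "convex T"
    using convex_affine_map_image[OF \<open>convex S\<close> h(1)] h(2) by (simp add: bij_betw_def)
  show ?thesis
    unfolding affine_transitive_def
  proof (intro ballI)
    fix x y assume xy: "x \<in> extreme_points T" "y \<in> extreme_points T"
    then have "?k x \<in> extreme_points S" "?k y \<in> extreme_points S"
      using extreme_points_affine_bij[OF k T] by auto
    then obtain f where f: "affine_map_on S f" "bij_betw f S S" "f (?k x) = ?k y"
      using assms(3) unfolding affine_transitive_def by blast
    have "affine_map_on T (h \<circ> (f \<circ> ?k))"
      by (intro affine_map_on_comp[OF affine_map_on_comp[OF k(1) f(1)] h(1)])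
         (use k(2) f(2) in \<open>auto simp: bij_betw_def\<close>)
    moreover have "bij_betw (h \<circ> (f \<circ> ?k)) T T"
      using bij_betw_trans[OF bij_betw_trans[OF k(2) f(2)] h(2)] .
    moreover have "(h \<circ> (f \<circ> ?k)) x = y"
      using f(3) xy sub h(2) by (auto simp: bij_betw_inv_into_right)
    ultimately show "\<exists>f. affine_map_on T f \<and> bij_betw f T T \<and> f x = y" by blast
  qed
qed

section \<open>Transitive group actions as existence of maps\<close>

text \<open>Restriction to \<open>E\<close> is a homomorphism because every element of
  \<open>H\<close> maps \<open>E\<close> onto itself. Both groups of the statement are instances,
  one of self-maps of the body and one with \<open>S = UNIV\<close>.\<close>

lemma transitive_action_restrictI:
  assumes sub: "subgroup H (BijGroup S)" and "E \<subseteq> S"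
    and bij: "\<And>f. f \<in> H \<Longrightarrow> bij_betw f E E"
    and tr: "\<And>x y. x \<in> E \<Longrightarrow> y \<in> E \<Longrightarrow> \<exists>f\<in>H. f x = y"
  shows "acts_transitively_on (BijGroup S\<lparr>carrier := H\<rparr>) E"
proof -
  have HB: "H \<subseteq> Bij S"
    using subgroup.subset[OF sub] by (simp add: BijGroup_def)
  have rB: "restrict f E \<in> Bij E" if "f \<in> H" for f
    using bij[OF that] by (auto simp: Bij_def cong: bij_betw_cong)
  have "(\<lambda>g. restrict g E) \<in> hom (BijGroup S\<lparr>carrier := H\<rparr>) (BijGroup E)"
  proof (rule homI)
    fix f g assume "f \<in> carrier (BijGroup S\<lparr>carrier := H\<rparr>)" "g \<in> carrier (BijGroup S\<lparr>carrier := H\<rparr>)"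
    then have fg: "f \<in> H" "g \<in> H" by auto
    then have "restrict (compose S f g) E = compose E (restrict f E) (restrict g E)"
      using bij[OF fg(2)] \<open>E \<subseteq> S\<close> by (auto simp: compose_def fun_eq_iff restrict_def bij_betw_def)
    with fg rB HB show "restrict (f \<otimes>\<^bsub>BijGroup S\<lparr>carrier := H\<rparr>\<^esub> g) E = restrict f E \<otimes>\<^bsub>BijGroup E\<^esub> restrict g E"
      by (auto simp: BijGroup_def)
  qed (use rB in \<open>simp add: BijGroup_def\<close>)
  then have "group_hom (BijGroup S\<lparr>carrier := H\<rparr>) (BijGroup E) (\<lambda>g. restrict g E)"
    using subgroup.subgroup_is_group[OF sub group_BijGroup] group_BijGroup
    by (simp add: group_hom_def group_hom_axioms_def)
  then show ?thesis
    using tr by (auto simp: transitive_action_def group_action_def transitive_action_axioms_def)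
qed

lemma subgroup_BijGroupI:
  assumes "H \<subseteq> Bij S" "(\<lambda>x\<in>S. x) \<in> H"
    and "\<And>f g. f \<in> H \<Longrightarrow> g \<in> H \<Longrightarrow> compose S f g \<in> H"
    and "\<And>f. f \<in> H \<Longrightarrow> restrict (inv_into S f) S \<in> H"
  shows "subgroup H (BijGroup S)"
  using assms by (intro subgroup.intro) (auto simp: inv_BijGroup subset_iff, auto simp: BijGroup_def subset_iff)

lemma acts_transitively_affine_aut_group:
  assumes "convex S"
  shows "acts_transitively_on (affine_aut_group S) (extreme_points S) \<longleftrightarrow> affine_transitive S"
proof
  assume "acts_transitively_on (affine_aut_group S) (extreme_points S)"
  then have "\<exists>g\<in>carrier (affine_aut_group S). restrict g (extreme_points S) x = y"
    if "x \<in> extreme_points S" "y \<in> extreme_points S" for x y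
    using that by (rule transitive_action.unique_orbit)
  then show "affine_transitive S"
    by (fastforce simp: affine_transitive_def affine_aut_group_def Bij_def)
next
  assume tr: "affine_transitive S"
  let ?H = "{f \<in> Bij S. affine_map_on S f}"
  have 1: "subgroup ?H (BijGroup S)"
  proof (rule subgroup_BijGroupI)
    show "(\<lambda>x\<in>S. x) \<in> ?H"
      using assms by (auto simp: id_Bij affine_map_on_def convex_alt)
    show "compose S f g \<in> ?H" if "f \<in> ?H" "g \<in> ?H" for f g
    proof -
      have "affine_map_on S (f \<circ> g)"
        using that affine_map_on_comp[of S g S f] by (auto simp: Bij_def bij_betw_def)
      then have "affine_map_on S (compose S f g)"
        using affine_map_on_cong[OF assms, of "f \<circ> g" "compose S f g"] by (auto simp: compose_def)
      then show ?thesis using that by (simp add: compose_Bij)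
    qed
    show "restrict (inv_into S f) S \<in> ?H" if "f \<in> ?H" for f
    proof -
      have "affine_map_on S (inv_into S f)"
        using that affine_map_on_inv assms by (auto simp: Bij_def)
      then have "affine_map_on S (restrict (inv_into S f) S)"
        using affine_map_on_cong[OF assms, of "inv_into S f" "restrict (inv_into S f) S"] by auto
      then show ?thesis using that by (simp add: restrict_inv_into_Bij)
    qed
  qed auto
  show "acts_transitively_on (affine_aut_group S) (extreme_points S)"
    unfolding affine_aut_group_def
  proof (rule transitive_action_restrictI[OF 1])
    show "extreme_points S \<subseteq> S"
      by (auto simp: extreme_points_def extreme_point_of_def)
    show "bij_betw f (extreme_points S) (extreme_points S)" if "f \<in> ?H" for f
      using that assms by (auto simp: Bij_def intro: bij_betw_extreme_points)
    show "\<exists>f\<in>?H. f x = y" if xy: "x \<in> extreme_points S" "y \<in> extreme_points S" for x y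
    proof -
      obtain f where f: "affine_map_on S f" "bij_betw f S S" "f x = y"
        using tr xy unfolding affine_transitive_def by blast
      have "affine_map_on S (restrict f S)"
        using f(1) affine_map_on_cong[OF assms, of f "restrict f S"] by auto
      moreover have "restrict f S \<in> Bij S"
        using f(2) by (auto simp: Bij_def cong: bij_betw_cong)
      moreover have "restrict f S x = y"
        using f(3) xy(1) by (auto simp: extreme_points_def extreme_point_of_def)
      ultimately show ?thesis by blast
    qed
  qed
qed

lemma acts_transitively_affine_isometry_group:
  fixes P :: "'a::euclidean_space set"
  assumes "convex P"
  shows "acts_transitively_on (affine_isometry_group P) (extreme_points P) \<longleftrightarrow>
    (\<forall>x\<in>extreme_points P. \<forall>y\<in>extreme_points P. \<exists>f. affine_map_on UNIV f \<and> bij f \<and>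
        (\<forall>x y. dist (f x) (f y) = dist x y) \<and> f ` P = P \<and> f x = y)"
    (is "_ \<longleftrightarrow> ?R")
proof
  assume "acts_transitively_on (affine_isometry_group P) (extreme_points P)"
  show ?R
  proof (intro ballI)
    fix x y assume xy: "x \<in> extreme_points P" "y \<in> extreme_points P"
    have "\<exists>g\<in>carrier (affine_isometry_group P). restrict g (extreme_points P) x = y"
      using transitive_action.unique_orbit[OF \<open>acts_transitively_on _ _\<close> xy] .
    with xy show "\<exists>f. affine_map_on UNIV f \<and> bij f \<and>
        (\<forall>x y. dist (f x) (f y) = dist x y) \<and> f ` P = P \<and> f x = y"
      by (auto simp: affine_isometry_group_def Bij_def)
  qed
next
  assume tr: ?R
  let ?H = "{f \<in> Bij UNIV. affine_map_on UNIV f \<and> (\<forall>x y. dist (f x) (f y) = dist x y) \<and> f ` P = P}"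
  have 1: "subgroup ?H (BijGroup UNIV)"
  proof (rule subgroup_BijGroupI)
    show "(\<lambda>x\<in>UNIV. x) \<in> ?H"
      by (simp add: id_Bij affine_map_on_def)
    show "compose UNIV f g \<in> ?H" if "f \<in> ?H" "g \<in> ?H" for f g
    proof -
      have "f ` g ` P = P" using that by simp
      then have "(\<lambda>x. f (g x)) ` P = P" by (simp add: image_image)
      then show ?thesis
        using that compose_Bij[of f UNIV g] affine_map_on_comp[of UNIV g UNIV f]
        by (simp add: compose_def o_def restrict_def)
    qed
    show "restrict (inv_into UNIV f) UNIV \<in> ?H" if "f \<in> ?H" for f
    proof -
      have b: "bij f" using that by (simp add: Bij_def)
      have fP: "f ` P = P" and fd: "\<And>u v. dist (f u) (f v) = dist u v"
        using that by auto
      have "dist (inv_into UNIV f x) (inv_into UNIV f y) = dist x y" for x y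
        using fd[of "inv_into UNIV f x" "inv_into UNIV f y"] b by (simp add: bij_is_surj surj_f_inv_f)
      moreover have "inv_into UNIV f ` P = P"
        using image_inv_f_f[OF bij_is_inj[OF b], of P] fP by simp
      moreover have "affine_map_on UNIV (inv_into UNIV f)"
        by (rule affine_map_on_inv[of UNIV f UNIV]) (use that b in auto)
      ultimately show ?thesis using that restrict_inv_into_Bij[of f UNIV] by (simp add: restrict_def)
    qed
  qed auto
  show "acts_transitively_on (affine_isometry_group P) (extreme_points P)"
    unfolding affine_isometry_group_def
  proof (rule transitive_action_restrictI[OF 1])
    show "bij_betw f (extreme_points P) (extreme_points P)" if "f \<in> ?H" for f
    proof (rule bij_betw_extreme_points)
      show "bij_betw f P P" using that by (auto simp: Bij_def bij_betw_def intro: inj_on_subset)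
    qed (use that assms in \<open>auto intro: affine_map_on_subset\<close>)
    show "\<exists>f\<in>?H. f x = y" if xy: "x \<in> extreme_points P" "y \<in> extreme_points P" for x y
      proof -
      obtain f where "affine_map_on UNIV f" "bij f" "\<forall>x y. dist (f x) (f y) = dist x y" "f ` P = P" "f x = y"
        using tr xy by blast
      then have "f \<in> ?H" by (simp add: Bij_def)
      with \<open>f x = y\<close> show ?thesis by blast
    qed
  qed auto
qed

text \<open>Along a ray from \<open>p\<close> the increment of \<open>f\<close> is proportional to
  the length travelled, as long as the ray stays in \<open>S\<close>. A short step in each direction
  therefore determines a candidate \<open>L\<close>, and every point of \<open>S\<close> lies on
  such a ray.\<close>

lemma affine_map_on_interior:
  fixes f :: "'a::real_normed_vector \<Rightarrow> 'b::real_vector"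
  assumes f: "affine_map_on S f" and p: "p \<in> interior S"
  obtains L where "linear L" "\<And>x. x \<in> S \<Longrightarrow> f x = f p + L (x - p)"
proof -
  obtain e where e: "e > 0" "cball p e \<subseteq> S"
    using p mem_interior_cball by blast
  then have pS: "p \<in> S" by auto
  have small: "p + t *\<^sub>R v \<in> S" if "0 \<le> t" "t * norm v \<le> e" for t v
    using e(2) that by (auto simp: dist_norm subset_iff)
  have shrink: "f (p + s *\<^sub>R v) - f p = (s / t) *\<^sub>R (f (p + t *\<^sub>R v) - f p)"
    if "0 < s" "s \<le> t" "p + t *\<^sub>R v \<in> S" for s t v
  proof -
    have "p + s *\<^sub>R v = (1 - s/t) *\<^sub>R p + (s/t) *\<^sub>R (p + t *\<^sub>R v)"
      using that by (simp add: algebra_simps)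
    then show ?thesis
      using affine_map_onD[OF f pS that(3), of "s/t"] that by (simp add: algebra_simps)
  qed
  \<comment> \<open>A step short enough to remain in the ball of radius \<open>e\<close>; the added
    1 keeps the denominator positive at \<open>v = 0\<close>.\<close>
  define s where "s v = e / (norm v + 1)" for v :: 'a
  have s: "s v > 0" "p + s v *\<^sub>R v \<in> S" for v
  proof -
    have n: "norm v + 1 > 0" by (simp add: add_nonneg_pos)
    then show "s v > 0" using e(1) by (simp add: s_def)
    moreover have "s v * norm v \<le> e" using n e(1) by (simp add: s_def field_simps)
    ultimately show "p + s v *\<^sub>R v \<in> S" by (simp add: small)
  qed
  define L where "L v = (1 / s v) *\<^sub>R (f (p + s v *\<^sub>R v) - f p)" for v
  have L: "f (p + t *\<^sub>R v) - f p = t *\<^sub>R L v" if "0 < t" "p + t *\<^sub>R v \<in> S" for t v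
  proof (cases "t \<le> s v")
    case True
    then show ?thesis using shrink[OF that(1) True s(2)] by (simp add: L_def)
  next
    case False
    then have "f (p + s v *\<^sub>R v) - f p = (s v / t) *\<^sub>R (f (p + t *\<^sub>R v) - f p)"
      using shrink[OF s(1) _ that(2)] by simp
    then show ?thesis using s(1)[of v] that(1) by (simp add: L_def)
  qed
  have add: "L (u + v) = L u + L v" for u v
  proof -
    \<comment> \<open>The point \<open>p + t *\<^sub>R (u + v)\<close> is the midpoint of
      \<open>p + (2*t) *\<^sub>R u\<close> and \<open>p + (2*t) *\<^sub>R v\<close>; the factor 2 in
      the denominator keeps the two endpoints in the ball.\<close>
    define t where "t = e / (2 * (norm u + norm v + 1))"
    have n: "norm u + norm v + 1 > 0" by (simp add: add_nonneg_pos)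
    have t0: "t > 0" using e(1) n by (simp add: t_def)
    have te: "2 * t * (norm u + norm v + 1) = e" using n unfolding t_def by (simp del: distrib_left_numeral)
    have "2 * t * norm u \<le> 2 * t * (norm u + norm v + 1)" "2 * t * norm v \<le> 2 * t * (norm u + norm v + 1)"
      using t0 by (auto intro!: mult_left_mono)
    moreover have "t * norm (u + v) \<le> (2 * t) * (norm u + norm v + 1)"
      using t0 norm_triangle_ineq[of u v] by (intro mult_mono) auto
    ultimately have t: "t > 0" "2 * t * norm u \<le> e" "2 * t * norm v \<le> e" "t * norm (u + v) \<le> e"
      using t0 te by auto
    have "p + t *\<^sub>R (u + v) = (1 - 1/2) *\<^sub>R (p + (2*t) *\<^sub>R u) + (1/2) *\<^sub>R (p + (2*t) *\<^sub>R v)"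
      by (simp add: algebra_simps flip: scaleR_add_left)
    then have "f (p + t *\<^sub>R (u + v)) = (1/2) *\<^sub>R f (p + (2*t) *\<^sub>R u) + (1/2) *\<^sub>R f (p + (2*t) *\<^sub>R v)"
      using affine_map_onD[OF f small[of "2*t" u] small[of "2*t" v], of "1/2"] t by simp
    moreover have "f (p + (2*t) *\<^sub>R u) = f p + (2*t) *\<^sub>R L u" "f (p + (2*t) *\<^sub>R v) = f p + (2*t) *\<^sub>R L v"
      "f (p + t *\<^sub>R (u + v)) = f p + t *\<^sub>R L (u + v)"
      using L[OF _ small, of "2*t" u] L[OF _ small, of "2*t" v] L[OF _ small, of t "u + v"] t by (auto simp: diff_eq_eq add.commute)
    ultimately have "t *\<^sub>R L (u + v) = t *\<^sub>R (L u + L v)"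
      by (simp add: algebra_simps flip: scaleR_add_left)
    then show ?thesis using t(1) by simp
  qed
  have L0: "L 0 = 0" using L[of 1 0] pS by simp
  have pos: "L (c *\<^sub>R v) = c *\<^sub>R L v" if "c > 0" for c v
  proof -
    define t where "t = s v / c"
    have t: "t > 0" "t * c = s v" using s(1)[of v] that by (auto simp: t_def)
    have "t *\<^sub>R L (c *\<^sub>R v) = f (p + t *\<^sub>R c *\<^sub>R v) - f p"
      using L[of t "c *\<^sub>R v"] t s(2)[of v] by simp
    also have "\<dots> = t *\<^sub>R c *\<^sub>R L v"
      using L[of "s v" v] t s[of v] by simp
    finally show ?thesis using t(1) by (metis less_irrefl scaleR_cancel_left)
  qed
  have "L (c *\<^sub>R v) = c *\<^sub>R L v" for c v
  proof (cases c "0::real" rule: linorder_cases)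
    case less
    then have "L (c *\<^sub>R v) + (- c) *\<^sub>R L v = 0"
      using add[of "c *\<^sub>R v" "(- c) *\<^sub>R v"] pos[of "- c" v] L0 by simp
    then show ?thesis by simp
  qed (auto simp: L0 pos)
  then have "linear L" using add by (simp add: linear_iff)
  moreover have "f x = f p + L (x - p)" if "x \<in> S" for x
    using L[of 1 "x - p"] that by (simp add: diff_eq_eq algebra_simps)
  ultimately show ?thesis using that by blast
qed

section \<open>Second moments of planar convex bodies\<close>

lemma absolutely_integrable_continuous_compact:
  fixes \<phi> :: "'a::euclidean_space \<Rightarrow> 'b::euclidean_space"
  assumes "compact S" "continuous_on UNIV \<phi>"
  shows "\<phi> absolutely_integrable_on S"
proof -
  obtain a b where ab: "S \<subseteq> cbox a b"
    using assms(1) bounded_subset_cbox_symmetric compact_imp_bounded by metis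
  have "\<phi> absolutely_integrable_on cbox a b"
    using assms(2) continuous_on_subset by (blast intro: absolutely_integrable_continuous)
  then show ?thesis
    by (rule set_integrable_subset) (use ab assms(1) in \<open>auto simp: lmeasurable_compact fmeasurableD\<close>)
qed

lemma integral_affine_change_of_variables_vec:
  fixes S :: "(real^'n::{finite,wellorder}) set" and \<phi> :: "real^'n::_ \<Rightarrow> real^'m"
  assumes S: "compact S" and A: "linear A" and inj: "inj_on f S"
    and f: "\<And>x. x \<in> S \<Longrightarrow> f x = A x + b" and \<phi>: "continuous_on UNIV \<phi>"
  shows "integral (f ` S) \<phi> = \<bar>det (matrix A)\<bar> *\<^sub>R integral S (\<lambda>x. \<phi> (f x))"
proof -
  let ?f = "\<lambda>x. A x + b"
  have bl: "bounded_linear A"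
    using A by (simp add: linear_conv_bounded_linear)
  note cA = linear_continuous_on[OF bl]
  have inj': "inj_on ?f S"
    using inj by (simp add: f inj_on_def)
  have der: "(?f has_derivative A) (at x within S)" for x
    using has_derivative_add_const[OF bounded_linear_imp_has_derivative[OF bl]] by simp
  have c: "continuous_on UNIV (\<lambda>x. \<phi> (?f x))"
    by (rule continuous_on_compose2[OF \<phi>]) (auto intro!: continuous_intros cA)
  have "(\<lambda>x. \<bar>det (matrix A)\<bar> *\<^sub>R \<phi> (?f x)) absolutely_integrable_on S"
    using c by (intro absolutely_integrable_continuous_compact[OF S] continuous_intros)
  then have "integral (?f ` S) \<phi> = integral S (\<lambda>x. \<bar>det (matrix A)\<bar> *\<^sub>R \<phi> (?f x))"
    using has_absolute_integral_change_of_variables_compact[OF S der inj', of \<phi>] by metis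
  moreover have "?f ` S = f ` S" using f by auto
  moreover have "integral S (\<lambda>x. \<phi> (?f x)) = integral S (\<lambda>x. \<phi> (f x))"
    by (rule integral_cong) (simp add: f)
  ultimately show ?thesis by simp
qed

text \<open>Follows from the vector-valued version by regarding a real function as one into
  \<open>real^1\<close>.\<close>

lemma integral_affine_change_of_variables:
  fixes S :: "(real^'n::{finite,wellorder}) set" and \<phi> :: "real^'n::_ \<Rightarrow> real"
  assumes S: "compact S" and A: "linear A" and inj: "inj_on f S"
    and f: "\<And>x. x \<in> S \<Longrightarrow> f x = A x + b" and \<phi>: "continuous_on UNIV \<phi>"
  shows "integral (f ` S) \<phi> = \<bar>det (matrix A)\<bar> * integral S (\<lambda>x. \<phi> (f x))"
proof -
  define \<psi> :: "real^'n::_ \<Rightarrow> real^1" where "\<psi> x = (\<chi> i. \<phi> x)" for x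
  have cont: "continuous_on UNIV \<psi>"
    unfolding \<psi>_def using \<phi> by (intro continuous_intros)
  have bl: "bounded_linear A"
    using A by (simp add: linear_conv_bounded_linear)
  note cA = linear_continuous_on[OF bl]
  have c: "continuous_on UNIV (\<lambda>x. \<psi> (A x + b))"
    by (rule continuous_on_compose2[OF cont]) (auto intro!: continuous_intros cA)
  have im: "compact (f ` S)"
  proof -
    have "f ` S = (\<lambda>x. A x + b) ` S" using f by auto
    then show ?thesis
      using S by (auto intro!: compact_continuous_image continuous_intros cA)
  qed
  have int: "(\<lambda>x. \<psi> (f x)) integrable_on S"
    using absolutely_integrable_continuous_compact[OF S c, THEN set_lebesgue_integral_eq_integral(1)]
    by (rule integrable_eq) (simp add: f)
  have int': "\<psi> integrable_on f ` S"
    using absolutely_integrable_continuous_compact[OF im cont] set_lebesgue_integral_eq_integral(1) by blast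
  have "integral (f ` S) \<psi> $ 1 = (\<bar>det (matrix A)\<bar> *\<^sub>R integral S (\<lambda>x. \<psi> (f x))) $ 1"
    using integral_affine_change_of_variables_vec[OF S A inj f cont] by simp
  moreover have "integral (f ` S) \<psi> $ 1 = integral (f ` S) \<phi>"
    using integral_linear[OF int' bounded_linear_vec_nth[of 1]] by (simp add: o_def \<psi>_def)
  moreover have "integral S (\<lambda>x. \<psi> (f x)) $ 1 = integral S (\<lambda>x. \<phi> (f x))"
    using integral_linear[OF int bounded_linear_vec_nth[of 1]] by (simp add: o_def \<psi>_def)
  ultimately show ?thesis by simp
qed

text \<open>Were the integral over a small box around \<open>x\<close> zero, the continuous
  nonnegative integrand would vanish on that box, in particular at \<open>x\<close>.\<close>

lemma integral_pos_interior:
  fixes \<phi> :: "'a::euclidean_space \<Rightarrow> real"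
  assumes "compact S" "continuous_on UNIV \<phi>" "\<And>x. 0 \<le> \<phi> x" "x \<in> interior S" "\<phi> x \<noteq> 0"
  shows "0 < integral S \<phi>"
proof -
  obtain a b where ab: "x \<in> box a b" "cbox a b \<subseteq> interior S"
    using open_contains_cbox[of "interior S"] assms(4) by (metis open_interior)
  have int: "\<phi> integrable_on T" if "compact T" for T
    using absolutely_integrable_continuous_compact[OF that assms(2)] set_lebesgue_integral_eq_integral(1) by blast
  have le: "integral (cbox a b) \<phi> \<le> integral S \<phi>"
    using ab(2) interior_subset[of S] assms(3) int[OF assms(1)] int[of "cbox a b"]
    by (intro integral_subset_le) auto
  have "integral (cbox a b) \<phi> \<noteq> 0"
  proof
    assume "integral (cbox a b) \<phi> = 0"
    then have "(\<phi> has_integral 0) (cbox a b)"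
      using int[of "cbox a b"] by (metis compact_cbox has_integral_integral)
    then have "\<phi> x = 0"
      using assms(2,3) ab(1) box_subset_cbox
      by (intro has_integral_0_cbox_imp_0[of a b \<phi> x]) (blast intro: continuous_on_subset)+
    with assms(5) show False by simp
  qed
  moreover have "0 \<le> integral (cbox a b) \<phi>"
    using assms(3) by (simp add: Henstock_Kurzweil_Integration.integral_nonneg int)
  ultimately show ?thesis using le by simp
qed

definition centroid :: "(real^'n) set \<Rightarrow> real^'n" where
  "centroid S = (1 / integral S (\<lambda>x. 1)) *\<^sub>R integral S (\<lambda>x. x)"

text \<open>Substituting along \<open>f\<close> in the integral of 1 shows that area is preserved,
  which gives the determinant. Substituting in the integral of the identity then shows that the
  affine extension of \<open>f\<close> fixes the centroid.\<close>

lemma affine_bij_centroid: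
  fixes S :: "(real^'n::{finite,wellorder}) set"
  assumes S: "compact S" "interior S \<noteq> {}" and f: "affine_map_on S f" "bij_betw f S S"
  obtains A where "linear A" "\<bar>det (matrix A)\<bar> = 1"
    "\<And>x. x \<in> S \<Longrightarrow> f x = A (x - centroid S) + centroid S"
proof -
  obtain p where p: "p \<in> interior S" using S(2) by blast
  obtain A where A: "linear A" and Ax: "\<And>x. x \<in> S \<Longrightarrow> f x = f p + A (x - p)"
    using affine_map_on_interior[OF f(1) p] by metis
  define b where "b = f p - A p"
  have fb: "f x = A x + b" if "x \<in> S" for x
    using Ax[OF that] A by (simp add: b_def linear_diff)
  have inj: "inj_on f S" and im: "f ` S = S" using f(2) by (auto simp: bij_betw_def)
  define V where "V = integral S (\<lambda>x. 1::real)"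
  have V: "V > 0"
    unfolding V_def using integral_pos_interior[OF S(1) _ _ p, of "\<lambda>x. 1"] by simp
  have det: "\<bar>det (matrix A)\<bar> = 1"
    using integral_affine_change_of_variables[OF S(1) A inj fb, of "\<lambda>x. 1"] V im by (simp add: V_def)
  have int: "(\<lambda>x. x) integrable_on S" "(\<lambda>x. b) integrable_on S" "(\<lambda>x. 1::real) integrable_on S"
    using absolutely_integrable_continuous_compact[OF S(1)] set_lebesgue_integral_eq_integral(1) continuous_on_id continuous_on_const
    by blast+
  have bl: "bounded_linear A"
    using A by (simp add: linear_conv_bounded_linear)
  have "integral S (\<lambda>x. x) = integral S f"
    using integral_affine_change_of_variables_vec[OF S(1) A inj fb, of "\<lambda>x. x"] im det by (simp add: eta_contract_eq)
  also have "\<dots> = integral S (\<lambda>x. A x + b)"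
    by (rule integral_cong) (simp add: fb)
  also have "\<dots> = integral S (\<lambda>x. A x) + integral S (\<lambda>x. b)"
    using integrable_linear[OF int(1) bl] int(2) by (intro Henstock_Kurzweil_Integration.integral_add) (auto simp: o_def)
  also have "integral S (\<lambda>x. A x) = A (integral S (\<lambda>x. x))"
    using integral_linear[OF int(1) bl] by (simp add: o_def)
  also have "integral S (\<lambda>x. b) = V *\<^sub>R b"
    using integral_linear[OF int(3) bounded_linear_scaleR_left[of b]] by (simp add: o_def V_def)
  finally have eq: "integral S (\<lambda>x. x) = A (integral S (\<lambda>x. x)) + V *\<^sub>R b" .
  have "A (centroid S) + b = (1 / V) *\<^sub>R (A (integral S (\<lambda>x. x)) + V *\<^sub>R b)"
    using V A by (simp add: centroid_def V_def[symmetric] linear_scale scaleR_add_right)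
  also have "\<dots> = (1 / V) *\<^sub>R integral S (\<lambda>x. x)"
    by (simp only: eq[symmetric])
  also have "\<dots> = centroid S"
    by (simp add: centroid_def V_def)
  finally have cen: "A (centroid S) + b = centroid S" .
  have "f x = A (x - centroid S) + centroid S" if "x \<in> S" for x
  proof -
    have "A (x - centroid S) + centroid S = A x - A (centroid S) + (A (centroid S) + b)"
      using A cen by (simp add: linear_diff)
    then show ?thesis using fb[OF that] by simp
  qed
  with A det show ?thesis using that by blast
qed

text \<open>The determinant with columns \<open>x\<close> and \<open>y\<close>, that is, twice the
  signed area of the triangle with vertices 0, \<open>x\<close>, \<open>y\<close>.\<close>

definition area2 :: "real^2 \<Rightarrow> real^2 \<Rightarrow> real" where
  "area2 x y = x $ 1 * y $ 2 - x $ 2 * y $ 1"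

lemma area2_linear:
  assumes "linear A"
  shows "area2 (A x) (A y) = det (matrix A) * area2 x y"
proof -
  have *: "A z = matrix A *v z" for z
    using assms by (simp add: matrix_vector_mul)
  show ?thesis
    by (subst (1 2) *) (simp add: area2_def det_2 matrix_vector_mult_def sum_2 algebra_simps)
qed

text \<open>Up to the factor 4, the integral of the squared area of the triangle spanned by the centroid,
  its translate by \<open>x\<close> and a variable point of \<open>S\<close>. Phrasing the second moments through areas makes
  the invariance under area-preserving maps evident.\<close>

definition moment_form :: "(real^2) set \<Rightarrow> real^2 \<Rightarrow> real" where
  "moment_form S x = integral S (\<lambda>y. (area2 x (y - centroid S))\<^sup>2)"

lemma continuous_on_area2 [continuous_intros]:
  "continuous_on T f \<Longrightarrow> continuous_on T g \<Longrightarrow> continuous_on T (\<lambda>y. area2 (f y) (g y))"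
  unfolding area2_def by (intro continuous_intros)

text \<open>Substituting \<open>f y\<close> for \<open>y\<close> costs nothing, since area is
  preserved. Both arguments of \<open>area2\<close> then carry a factor \<open>A\<close>, which
  comes out as \<open>det (matrix A)\<close>, and its square is 1.\<close>

lemma moment_form_invariant:
  assumes S: "compact S" "interior S \<noteq> {}" and f: "bij_betw f S S"
    and A: "linear A" "\<bar>det (matrix A)\<bar> = 1" "\<And>x. x \<in> S \<Longrightarrow> f x = A (x - centroid S) + centroid S"
  shows "moment_form S (A x) = moment_form S x"
proof -
  have inj: "inj_on f S" and im: "f ` S = S" using f by (auto simp: bij_betw_def)
  have fb: "f x = A x + (centroid S - A (centroid S))" if "x \<in> S" for x
    using A that by (simp add: linear_diff)
  have "moment_form S (A x) = integral S (\<lambda>y. (area2 (A x) (f y - centroid S))\<^sup>2)"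
    using integral_affine_change_of_variables[OF S(1) A(1) inj fb, of "\<lambda>y. (area2 (A x) (y - centroid S))\<^sup>2"]
      im A(2) by (simp add: moment_form_def continuous_intros)
  also have "\<dots> = integral S (\<lambda>y. (area2 x (y - centroid S))\<^sup>2)"
  proof (rule integral_cong)
    fix y assume "y \<in> S"
    have "(det (matrix A))\<^sup>2 = 1"
      using A(2) by (metis power2_abs power_one)
    then show "(area2 (A x) (f y - centroid S))\<^sup>2 = (area2 x (y - centroid S))\<^sup>2"
      using A(3)[OF \<open>y \<in> S\<close>] area2_linear[OF A(1)] by (simp add: power_mult_distrib)
  qed
  finally show ?thesis by (simp add: moment_form_def)
qed

text \<open>The integrand is the square of an affine function of \<open>y\<close>. If that function
  vanished on a ball, shifts along the two axes would show that both coordinates of \<open>x\<close>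
  are 0.\<close>

lemma moment_form_pos:
  assumes S: "compact S" "interior S \<noteq> {}" and "x \<noteq> 0"
  shows "0 < moment_form S x"
proof -
  obtain p where p: "p \<in> interior S" using S(2) by blast
  obtain e where e: "e > 0" "ball p e \<subseteq> interior S"
    using p open_contains_ball[of "interior S"] by auto
  have "\<exists>q\<in>interior S. area2 x (q - centroid S) \<noteq> 0"
  proof (rule ccontr)
    assume *: "\<not> ?thesis"
    have "area2 x (axis i 1) = 0" for i
    proof -
      let ?q = "p + (e/2) *\<^sub>R axis i 1"
      have "?q \<in> ball p e" using e(1) by (simp add: dist_norm)
      then have "area2 x (?q - centroid S) = 0" "area2 x (p - centroid S) = 0"
        using * p e(2) by auto
      moreover have "area2 x (?q - centroid S) = area2 x (p - centroid S) + (e / 2) * area2 x (axis i 1)"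
        by (simp add: area2_def algebra_simps)
      ultimately have "(e / 2) * area2 x (axis i 1) = 0" by simp
      then show ?thesis using e(1) by simp
    qed
    from this[of 1] this[of 2] have "x $ 1 = 0" "x $ 2 = 0"
      by (auto simp: area2_def axis_def)
    with \<open>x \<noteq> 0\<close> show False by (simp add: vec_eq_iff forall_2)
  qed
  then obtain q where "q \<in> interior S" "area2 x (q - centroid S) \<noteq> 0" by blast
  then show ?thesis
    unfolding moment_form_def by (intro integral_pos_interior[OF S(1)]) (auto intro!: continuous_intros)
qed

lemma moment_form_quadratic:
  assumes "compact S"
  shows "\<exists>a b d. \<forall>x. moment_form S x = a * (x $ 1)\<^sup>2 + 2 * b * (x $ 1 * x $ 2) + d * (x $ 2)\<^sup>2"
proof -
  let ?y = "\<lambda>i (y::real^2). (y - centroid S) $ i"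
  have int: "(\<lambda>y. k * (?y i y * ?y j y)) integrable_on S" for i j k
    by (intro set_lebesgue_integral_eq_integral(1) absolutely_integrable_continuous_compact[OF assms] continuous_intros)
  have add: "integral S (\<lambda>y. F y + G y + H y) = integral S F + integral S G + integral S H"
    if "F integrable_on S" "G integrable_on S" "H integrable_on S" for F G H :: "real^2 \<Rightarrow> real"
    using that by (simp add: Henstock_Kurzweil_Integration.integral_add integrable_add)
  \<comment> \<open>The coefficients are the central second moments, with the coordinates exchanged
    and a sign in the mixed term, because \<open>area2 x\<close> is the inner product with
    \<open>x\<close> turned by a right angle.\<close>
  have "moment_form S x = integral S (\<lambda>y. ?y 2 y * ?y 2 y) * (x $ 1)\<^sup>2
     + 2 * (- integral S (\<lambda>y. ?y 1 y * ?y 2 y)) * (x $ 1 * x $ 2) + integral S (\<lambda>y. ?y 1 y * ?y 1 y) * (x $ 2)\<^sup>2" for x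
  proof -
    have "moment_form S x = integral S (\<lambda>y. (x $ 1)\<^sup>2 * (?y 2 y * ?y 2 y)
      + (- 2 * (x $ 1 * x $ 2)) * (?y 1 y * ?y 2 y) + (x $ 2)\<^sup>2 * (?y 1 y * ?y 1 y))"
      unfolding moment_form_def by (rule integral_cong) (simp add: area2_def power2_eq_square algebra_simps)
    also have "\<dots> = integral S (\<lambda>y. (x $ 1)\<^sup>2 * (?y 2 y * ?y 2 y))
      + integral S (\<lambda>y. (- 2 * (x $ 1 * x $ 2)) * (?y 1 y * ?y 2 y)) + integral S (\<lambda>y. (x $ 2)\<^sup>2 * (?y 1 y * ?y 1 y))"
      by (intro add int)
    finally show ?thesis by (simp add: mult.commute)
  qed
  then show ?thesis by blast
qed

section \<open>Coordinates that make the moment form Euclidean\<close>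

text \<open>Completing the square writes the form as the sum of the squares of
  \<open>r * x $ 1 + b / r * x $ 2\<close> and \<open>s * x $ 2\<close>; these become the real and
  imaginary parts of \<open>B x\<close>, and back substitution gives \<open>C\<close>.\<close>

lemma positive_quadratic_form_norm:
  fixes q :: "real^2 \<Rightarrow> real"
  assumes q: "\<And>x. q x = a * (x $ 1)\<^sup>2 + 2 * b * (x $ 1 * x $ 2) + d * (x $ 2)\<^sup>2"
    and pos: "\<And>x. x \<noteq> 0 \<Longrightarrow> 0 < q x"
  obtains B :: "real^2 \<Rightarrow> complex" and C where "linear B" "linear C" "\<And>x. C (B x) = x" "\<And>w. B (C w) = w"
    "\<And>x. (norm (B x))\<^sup>2 = q x"
proof -
  have a: "a > 0" using pos[of "vector [1, 0]"] by (simp add: q vec_eq_iff forall_2)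
  \<comment> \<open>This vector minimizes the form on the line where the second coordinate is 1, so
    its value is what remains after completing the square.\<close>
  have "0 < q (vector [- (b / a), 1])" by (rule pos) (simp add: vec_eq_iff forall_2)
  also have "\<dots> = d - b\<^sup>2 / a" using a by (simp add: q power2_eq_square field_simps)
  finally have d: "d - b\<^sup>2 / a > 0" .
  define r s where "r = sqrt a" and "s = sqrt (d - b\<^sup>2 / a)"
  have r: "r > 0" "r\<^sup>2 = a" and s: "s > 0" "s\<^sup>2 = d - b\<^sup>2 / a"
    using a d by (auto simp: r_def s_def)
  define B where "B x = Complex (r * x $ 1 + b / r * x $ 2) (s * x $ 2)" for x :: "real^2"
  define C where "C w = (vector [(Re w - b / r * (Im w / s)) / r, Im w / s] :: real^2)" for w
  show ?thesis
  proof
    show "linear B"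
      by (rule linearI) (simp_all add: B_def complex_eq_iff algebra_simps)
    show "linear C"
      using r s by (intro linearI) (simp_all add: C_def vec_eq_iff forall_2 field_simps)
    show "C (B x) = x" for x
      using r s by (simp add: B_def C_def vec_eq_iff forall_2)
    show "B (C w) = w" for w
      using r s by (simp add: B_def C_def complex_eq_iff)
    show "(norm (B x))\<^sup>2 = q x" for x
    proof -
      have "(norm (B x))\<^sup>2 = r\<^sup>2 * (x $ 1)\<^sup>2 + 2 * b * (x $ 1 * x $ 2) + (b\<^sup>2 / r\<^sup>2 + s\<^sup>2) * (x $ 2)\<^sup>2"
        unfolding cmod_power2 using r(1) by (simp add: B_def power2_eq_square field_simps)
      then show ?thesis by (simp add: q r(2) s(2))
    qed
  qed
qed

text \<open>Here \<open>T\<close> is \<open>S\<close> with its centroid moved to 0 and then mapped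
  by \<open>B\<close>. An automorphism of \<open>T\<close>, conjugated back to \<open>S\<close>, has
  a linear part \<open>A\<close> that preserves the moment form, and \<open>B\<close> turns this
  form into the squared norm.\<close>

lemma orthogonal_model:
  fixes S :: "(real^2) set"
  assumes S: "compact S" "convex S" "interior S \<noteq> {}"
  obtains T :: "complex set" where "affine_isomorphic S T" "compact T" "convex T" "aff_dim T = 2"
    "\<And>g. affine_map_on T g \<Longrightarrow> bij_betw g T T \<Longrightarrow> \<exists>G. orthogonal_transformation G \<and> (\<forall>x\<in>T. g x = G x)"
proof -
  let ?c = "centroid S"
  obtain a b d where q: "\<And>x. moment_form S x = a * (x $ 1)\<^sup>2 + 2 * b * (x $ 1 * x $ 2) + d * (x $ 2)\<^sup>2"
    using moment_form_quadratic[OF S(1)] by blast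
  obtain B :: "real^2 \<Rightarrow> complex" and C where B: "linear B" "linear C" and CB: "\<And>x. C (B x) = x" and BC: "\<And>w. B (C w) = w"
    and nB: "\<And>x. (norm (B x))\<^sup>2 = moment_form S x"
    by (rule positive_quadratic_form_norm[OF q moment_form_pos[OF S(1,3)]])
       (assumption, rule that, assumption, assumption, blast+)
  have injB: "inj B" by (metis CB injI)
  \<comment> \<open>The summand 0 gives \<open>h\<close> the shape expected by
    \<open>affine_map_on_linear\<close>.\<close>
  define h where "h x = B (x - ?c) + 0" for x
  define T where "T = h ` S"
  have h: "affine_map_on S h"
    unfolding h_def by (rule affine_map_on_linear[OF B(1)])
  have bh: "bij_betw h S T"
    unfolding T_def h_def by (rule inj_on_imp_bij_betw) (use injB in \<open>auto intro!: inj_onI dest!: injD\<close>)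
  show ?thesis
  proof
    show "affine_isomorphic S T" using h bh by (auto simp: affine_isomorphic_def)
    show "compact T"
    proof -
      have "continuous_on S h"
        unfolding h_def add_0_right
        by (rule linear_continuous_on_compose[OF _ B(1)]) (intro continuous_intros)
      then show ?thesis unfolding T_def using S(1) by (rule compact_continuous_image)
    qed
    show "convex T" unfolding T_def by (rule convex_affine_map_image[OF S(2) h])
    have "T = B ` ((\<lambda>x. x - ?c) ` S)" by (auto simp: T_def h_def)
    then have "aff_dim T = aff_dim S"
      using aff_dim_injective_linear_image[OF B(1) injB] by (simp add: aff_dim_translation_eq_subtract)
    then show "aff_dim T = 2" using aff_dim_nonempty_interior[OF S(3)] by simp
    fix g assume g: "affine_map_on T g" "bij_betw g T T"
    let ?k = "inv_into S h"
    define f where "f = ?k \<circ> (g \<circ> h)"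
    have f: "affine_map_on S f"
      unfolding f_def using g bh
      by (intro affine_map_on_comp[OF affine_map_on_comp[OF h g(1)] affine_map_on_inv[OF h bh S(2)]])
         (auto simp: bij_betw_def)
    have bf: "bij_betw f S S"
      unfolding f_def using bij_betw_trans[OF bij_betw_trans[OF bh g(2)] bij_betw_inv_into[OF bh]] .
    obtain A where A: "linear A" "\<bar>det (matrix A)\<bar> = 1" "\<And>x. x \<in> S \<Longrightarrow> f x = A (x - ?c) + ?c"
      using affine_bij_centroid[OF S(1,3) f bf] by metis
    define G where "G = B \<circ> (A \<circ> C)"
    have "linear G" unfolding G_def using A(1) B by (intro linear_compose) auto
    moreover have "norm (G w) = norm w" for w
    proof -
      have "(norm (G w))\<^sup>2 = moment_form S (A (C w))" by (simp add: G_def nB)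
      also have "\<dots> = moment_form S (C w)" by (rule moment_form_invariant[OF S(1,3) bf A])
      also have "\<dots> = (norm w)\<^sup>2" by (simp flip: nB add: BC)
      finally show ?thesis by simp
    qed
    moreover have "g w = G w" if "w \<in> T" for w
    proof -
      obtain x where x: "x \<in> S" "w = h x" using \<open>w \<in> T\<close> by (auto simp: T_def)
      have "g w \<in> T" using g(2) that by (auto simp: bij_betw_def)
      then have "g w = h (f x)" using bh by (simp add: f_def x(2) bij_betw_inv_into_right)
      then show ?thesis using A(3)[OF x(1)] x(2) by (simp add: h_def G_def CB)
    qed
    ultimately show "\<exists>G. orthogonal_transformation G \<and> (\<forall>x\<in>T. g x = G x)"
      by (auto simp: orthogonal_transformation)
  qed
qed

section \<open>Groups of plane isometries with an infinite orbit\<close>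

text \<open>The map is determined by its values at 1 and \<open>\<i>\<close>. Dividing by
  \<open>z = G 1\<close> leaves a unit number \<open>v\<close> as the image of \<open>\<i>\<close>;
  comparing the lengths of \<open>1 + v\<close> and \<open>1 + \<i>\<close> makes \<open>v\<close>
  purely imaginary, so it is \<open>\<i>\<close> or \<open>- \<i>\<close>.\<close>

lemma orthogonal_transformation_complex:
  fixes G :: "complex \<Rightarrow> complex"
  assumes G: "orthogonal_transformation G"
  obtains z where "norm z = 1" "(\<forall>x. G x = z * x) \<or> (\<forall>x. G x = z * cnj x)"
proof -
  have lin: "linear G" and nG: "norm (G x) = norm x" for x
    using G by (auto simp: orthogonal_transformation)
  define z v where "z = G 1" and "v = G \<i> / z"
  have z: "norm z = 1" by (simp add: z_def nG)
  then have [simp]: "z \<noteq> 0" by auto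
  have v: "norm v = 1" "G \<i> = z * v"
    by (simp_all add: v_def norm_divide z nG)
  have Gx: "G x = z * (of_real (Re x) + of_real (Im x) * v)" for x
  proof -
    have "G x = G (Re x *\<^sub>R 1 + Im x *\<^sub>R \<i>)"
      by (rule arg_cong[where f=G]) (simp add: complex_eq_iff)
    also have "\<dots> = Re x *\<^sub>R z + Im x *\<^sub>R (z * v)"
      using lin by (simp add: linear_add linear_scale z_def[symmetric] v(2))
    finally show ?thesis by (simp add: scaleR_conv_of_real algebra_simps)
  qed
  have "norm (1 + v) = norm (1 + \<i>)"
    using Gx[of "1 + \<i>"] nG[of "1 + \<i>"] z by (simp add: norm_mult)
  then have "(norm (1 + v))\<^sup>2 = (norm (1 + \<i>))\<^sup>2" by simp
  moreover have "(Re v)\<^sup>2 + (Im v)\<^sup>2 = 1" using v(1) by (metis cmod_power2 power_one)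
  moreover from calculation have "Re v = 0"
    unfolding cmod_power2 by (simp add: power2_eq_square algebra_simps)
  ultimately have "Re v = 0" "(Im v)\<^sup>2 = 1" by simp_all
  then have "v = \<i> \<or> v = - \<i>"
    by (auto simp: complex_eq_iff power2_eq_1_iff)
  then have "(\<forall>x. G x = z * x) \<or> (\<forall>x. G x = z * cnj x)"
    by (auto simp: Gx complex_eq_iff)
  with z that show ?thesis by blast
qed

text \<open>A chord of the unit circle is no longer than its arc.\<close>

lemma cis_dist_le: "norm (cis a - cis b) \<le> \<bar>a - b\<bar>"
proof -
  have "norm (cis a - cis b) = norm (cis b * (cis (a - b) - 1))"
    by (simp add: algebra_simps cis_mult)
  also have "\<dots> = 2 * \<bar>sin ((a - b) / 2)\<bar>"
    by (simp add: norm_mult cis_conv_exp dist_exp_i_1 del: norm_cis of_real_diff)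
  also have "\<dots> \<le> \<bar>a - b\<bar>"
    using abs_sin_x_le_abs_x[of "(a - b) / 2"] by simp
  finally show ?thesis .
qed

text \<open>Divide the target angle by the step \<theta> and round down; the remaining angle is at
  most one step.\<close>

lemma small_rotation_orbit_dense:
  assumes "\<theta> \<noteq> 0"
  obtains n :: nat where "norm (cis (real n * \<theta>) - cis \<phi>) \<le> \<bar>\<theta>\<bar>"
proof -
  \<comment> \<open>Only natural multiples of \<theta> are available, so full turns are added to
    \<phi> until the quotient is nonnegative.\<close>
  obtain k :: int where k: "0 \<le> (\<phi> + 2 * pi * of_int k) / \<theta>"
  proof (cases "\<theta> > 0")
    case True
    obtain k where "- \<phi> / (2 * pi) \<le> of_int k" using ex_le_of_int by blast
    then have "0 \<le> \<phi> + 2 * pi * of_int k" by (simp add: field_simps)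
    with True show ?thesis by (intro that[of k]) simp
  next
    case False
    obtain k where "of_int k \<le> - \<phi> / (2 * pi)" using ex_of_int_less less_imp_le by blast
    then have "\<phi> + 2 * pi * of_int k \<le> 0" by (simp add: field_simps)
    with False assms show ?thesis by (intro that[of k] divide_nonpos_nonpos) auto
  qed
  define t where "t = (\<phi> + 2 * pi * of_int k) / \<theta>"
  define n where "n = nat \<lfloor>t\<rfloor>"
  have n: "\<bar>real n - t\<bar> \<le> 1" using k unfolding n_def t_def[symmetric] by linarith
  have "norm (cis (real n * \<theta>) - cis \<phi>) = norm (cis (real n * \<theta>) - cis (t * \<theta>))"
    using assms by (simp add: t_def cis_mult[symmetric])
  also have "\<dots> \<le> \<bar>real n - t\<bar> * \<bar>\<theta>\<bar>"
    using cis_dist_le[of "real n * \<theta>" "t * \<theta>"] by (simp add: abs_mult left_diff_distrib[symmetric])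
  also have "\<dots> \<le> \<bar>\<theta>\<bar>" using n by (simp add: mult_left_le_one_le)
  finally show ?thesis by (rule that)
qed

lemma infinite_orbit_dense:
  fixes E :: "complex set"
  assumes inf: "infinite E" and sph: "E \<subseteq> sphere 0 r" and r: "r > 0"
    and tr: "\<And>u v. u \<in> E \<Longrightarrow> v \<in> E \<Longrightarrow> \<exists>G. orthogonal_transformation G \<and> G ` E \<subseteq> E \<and> G u = v"
  shows "sphere 0 r \<subseteq> closure E"
proof
  fix p :: complex assume p: "p \<in> sphere 0 r"
  have "\<exists>x\<in>E. dist x p < e" if e: "e > 0" for e
  proof -
    \<comment> \<open>Two angles within \<delta> of a common point differ by less than
      \<open>2 * \<delta>\<close>, which on the circle of radius \<open>r\<close> amounts to an arc
      shorter than \<open>e / 2\<close>.\<close>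
    define \<delta> where "\<delta> = e / (4 * r)"
    have \<delta>: "\<delta> > 0" using e r by (simp add: \<delta>_def)
    \<comment> \<open>The closed interval gives compactness for the accumulation point. That 0 and
      \<open>2 * pi\<close> name the same point does no harm, since only a nonzero difference of
      angles is used.\<close>
    define \<Theta> where "\<Theta> = {\<theta> \<in> {0..2*pi}. of_real r * cis \<theta> \<in> E}"
    have "E \<subseteq> (\<lambda>\<theta>. of_real r * cis \<theta>) ` \<Theta>"
    proof
      fix x assume x: "x \<in> E"
      then have "x = of_real r * cis (Arg2pi x)"
        using Arg2pi_eq[of x] sph by (auto simp: cis_conv_exp)
      moreover have "Arg2pi x \<in> {0..2*pi}"
        using Arg2pi_ge_0[of x] Arg2pi_lt_2pi[of x] by simp
      ultimately show "x \<in> (\<lambda>\<theta>. of_real r * cis \<theta>) ` \<Theta>"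
        using x by (auto simp: \<Theta>_def intro!: image_eqI[of _ _ "Arg2pi x"])
    qed
    then have "infinite \<Theta>" using inf by (meson finite_surj)
    moreover have "\<Theta> \<subseteq> {0..2*pi}" by (auto simp: \<Theta>_def)
    ultimately obtain l where "l islimpt \<Theta>"
      using compact_eq_Bolzano_Weierstrass[of "{0..2*pi}"] by auto
    then have "infinite (\<Theta> \<inter> ball l \<delta>)"
      using \<delta> by (auto simp: islimpt_eq_infinite_ball)
    then obtain D where "D \<subseteq> \<Theta> \<inter> ball l \<delta>" "card D = 3"
      using infinite_arbitrarily_large by blast
    then obtain a b c where abc: "a \<in> \<Theta> \<inter> ball l \<delta>" "b \<in> \<Theta> \<inter> ball l \<delta>" "c \<in> \<Theta> \<inter> ball l \<delta>"
      "a \<noteq> b" "b \<noteq> c" "a \<noteq> c"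
      by (auto simp: card_3_iff)
    have rot: "\<exists>z. (\<forall>x\<in>E. z * x \<in> E) \<and> z = cis (\<beta> - \<alpha>)"
      if "\<forall>x\<in>E. z * x \<in> E" "z * (of_real r * cis \<alpha>) = of_real r * cis \<beta>" for z \<alpha> \<beta>
    proof -
      have "z * cis \<alpha> = cis \<beta>" using that(2) r by (simp add: mult.left_commute)
      then have "z = cis (\<beta> - \<alpha>)" by (simp add: cis_divide[symmetric] field_simps)
      with that(1) show ?thesis by blast
    qed
    have "\<exists>\<alpha>\<in>{a,b,c}. \<exists>\<beta>\<in>{a,b,c}. \<alpha> \<noteq> \<beta> \<and> (\<forall>x\<in>E. cis (\<beta> - \<alpha>) * x \<in> E)"
    proof -
      let ?p = "\<lambda>\<theta>. of_real r * cis \<theta>"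
      have E: "?p a \<in> E" "?p b \<in> E" "?p c \<in> E" using abc by (auto simp: \<Theta>_def)
      obtain G where G: "orthogonal_transformation G" "G ` E \<subseteq> E" "G (?p a) = ?p b"
        using tr[OF E(1,2)] by blast
      obtain H where H: "orthogonal_transformation H" "H ` E \<subseteq> E" "H (?p a) = ?p c"
        using tr[OF E(1,3)] by blast
      obtain z where z: "norm z = 1" "(\<forall>x. G x = z * x) \<or> (\<forall>x. G x = z * cnj x)"
        using orthogonal_transformation_complex[OF G(1)] by blast
      obtain w where w: "norm w = 1" "(\<forall>x. H x = w * x) \<or> (\<forall>x. H x = w * cnj x)"
        using orthogonal_transformation_complex[OF H(1)] by blast
      consider "\<forall>x. G x = z * x" | "\<forall>x. H x = w * x" | "\<forall>x. G x = z * cnj x" "\<forall>x. H x = w * cnj x"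
        using z w by blast
      then show ?thesis
      proof cases
        case 1
        then have "\<forall>x\<in>E. z * x \<in> E" using G(2) by (metis image_subset_iff)
        then show ?thesis using rot[of z a b] G(3) 1 abc by auto
      next
        case 2
        then have "\<forall>x\<in>E. w * x \<in> E" using H(2) by (metis image_subset_iff)
        then show ?thesis using rot[of w a c] H(3) 2 abc by auto
      next
        case 3
        txt \<open>A reflection is its own inverse, so \<open>H \<circ> G\<close> is a rotation carrying the second point
          to the third.\<close>
        have HG: "H (G x) = w * cnj z * x" for x using 3 by simp
        have "\<forall>x\<in>E. w * cnj z * x \<in> E" using G(2) H(2) by (metis HG image_subset_iff)
        moreover have "G (?p b) = ?p a"
          using G(3) 3(1) z(1) by (metis complex_cnj_cnj complex_cnj_mult complex_mod_sqrt_Re_mult_cnj complex_norm_square mult.assoc mult.left_neutral of_real_1 power_one)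
        then have "w * cnj z * ?p b = ?p c" using H(3) HG by metis
        ultimately show ?thesis using rot[of "w * cnj z" b c] abc by auto
      qed
    qed
    then obtain \<alpha> \<beta> where \<alpha>\<beta>: "\<alpha> \<in> {a,b,c}" "\<beta> \<in> {a,b,c}" "\<alpha> \<noteq> \<beta>" "\<forall>x\<in>E. cis (\<beta> - \<alpha>) * x \<in> E"
      by blast
    define \<theta> where "\<theta> = \<beta> - \<alpha>"
    have \<theta>: "\<theta> \<noteq> 0" "\<bar>\<theta>\<bar> < 2 * \<delta>"
      using \<alpha>\<beta> abc by (auto simp: \<theta>_def dist_real_def)
    have u: "of_real r * cis a \<in> E" using abc by (auto simp: \<Theta>_def)
    have orbit: "cis (real n * \<theta>) * (of_real r * cis a) \<in> E" for n
    proof (induction n)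
      case (Suc n)
      then have "cis \<theta> * (cis (real n * \<theta>) * (of_real r * cis a)) \<in> E"
        using \<alpha>\<beta>(4) by (simp add: \<theta>_def)
      then show ?case by (simp add: distrib_right cis_mult[symmetric] mult.assoc)
    qed (use u in simp)
    have pr: "p = of_real r * cis (Arg2pi p)"
      using Arg2pi_eq[of p] p by (auto simp: cis_conv_exp)
    \<comment> \<open>The orbit starts at angle \<open>a\<close>, so the rotation has to cover the
      angle from there to \<open>p\<close>.\<close>
    obtain n where n: "norm (cis (real n * \<theta>) - cis (Arg2pi p - a)) \<le> \<bar>\<theta>\<bar>"
      using small_rotation_orbit_dense[OF \<theta>(1)] by blast
    have "cis (real n * \<theta>) * (of_real r * cis a) - p = of_real r * cis a * (cis (real n * \<theta>) - cis (Arg2pi p - a))"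
      by (subst pr) (simp add: algebra_simps cis_mult)
    then have "dist (cis (real n * \<theta>) * (of_real r * cis a)) p \<le> r * \<bar>\<theta>\<bar>"
      using n r by (simp add: dist_norm norm_mult)
    also have "\<dots> < r * (2 * \<delta>)" using \<theta>(2) r by simp
    also have "\<dots> < e" using r e by (simp add: \<delta>_def)
    finally show ?thesis using orbit by blast
  qed
  then show "p \<in> closure E" by (auto simp: closure_approachable)
qed

section \<open>The disk and the polygon as models\<close>

lemma unit_disk_eq_cball: "unit_disk = cball 0 1"
proof -
  have "norm p \<le> 1 \<longleftrightarrow> (p $ 1)\<^sup>2 + (p $ 2)\<^sup>2 \<le> 1" for p :: "real^2"
    by (simp add: norm_eq_sqrt_inner inner_vec_def sum_2 power2_eq_square)
  then show ?thesis by (simp only: unit_disk_def set_eq_iff mem_Collect_eq mem_cball_0 simp_thms)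
qed

text \<open>Extreme points are not interior, so they have norm 1, and some orthogonal map takes one
  unit vector to another.\<close>

lemma affine_transitive_unit_disk: "affine_transitive unit_disk"
  unfolding affine_transitive_def unit_disk_eq_cball
proof (intro ballI)
  fix x y :: "real^2" assume xy: "x \<in> extreme_points (cball 0 1)" "y \<in> extreme_points (cball 0 1)"
  have "norm z = 1" if "z \<in> extreme_points (cball 0 1)" for z :: "real^2"
    using that extreme_point_not_in_interior[of z "cball 0 1"]
    by (auto simp: extreme_points_def extreme_point_of_def)
  then have "norm x = norm y" using xy by simp
  then obtain G where G: "orthogonal_transformation G" "G x = y"
    using orthogonal_transformation_exists by blast
  have "affine_map_on (cball 0 1) G"
    using affine_map_on_linear[of G "cball 0 1" 0 0] G(1) by (simp add: orthogonal_transformation)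
  moreover have "bij_betw G (cball 0 1) (cball 0 1)"
    using G(1) orthogonal_transformation_inj[OF G(1)] image_orthogonal_transformation_cball[OF G(1), of 0 1]
    by (auto simp: bij_betw_def linear_0 orthogonal_transformation_linear intro: inj_on_subset)
  ultimately show "\<exists>f. affine_map_on (cball 0 1) f \<and> bij_betw f (cball 0 1) (cball 0 1) \<and> f x = y"
    using G(2) by blast
qed

lemma affine_isomorphic_cball_unit_disk:
  assumes "r > 0"
  shows "affine_isomorphic (cball (0::complex) r) unit_disk"
proof -
  have "DIM(complex) = DIM(real^2)" by simp
  then obtain J :: "complex \<Rightarrow> real^2" and K where J: "linear J" "linear K" "\<And>x. norm (J x) = norm x"
    "\<And>y. norm (K y) = norm y" "\<And>x. K (J x) = x" "\<And>y. J (K y) = y"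
    by (rule isomorphisms_UNIV_UNIV) (rule that, assumption, assumption, blast+)
  let ?L = "\<lambda>x. J (x /\<^sub>R r)"
  have L: "linear ?L"
    using linear_compose[OF linear_scaleR[of "inverse r"] J(1)] by (simp add: o_def)
  have "inj ?L"
  proof (rule injI)
    fix x y assume "?L x = ?L y"
    then have "x /\<^sub>R r = y /\<^sub>R r" by (metis J(5))
    then show "x = y" using assms by simp
  qed
  moreover have "affine_map_on (cball 0 r) ?L"
    using affine_map_on_linear[OF L, of "cball 0 r" 0 0] by simp
  moreover have "?L ` cball 0 r = cball 0 1"
  proof
    show "?L ` cball 0 r \<subseteq> cball 0 1" using assms by (auto simp: J(3) divide_simps)
    show "cball 0 1 \<subseteq> ?L ` cball 0 r"
    proof
      fix y :: "real^2" assume "y \<in> cball 0 1"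
      then have "r *\<^sub>R K y \<in> cball 0 r" "y = ?L (r *\<^sub>R K y)"
        using assms J(4,6) by (auto simp: mult_left_le)
      then show "y \<in> ?L ` cball 0 r" by blast
    qed
  qed
  ultimately show ?thesis
    unfolding affine_isomorphic_def unit_disk_eq_cball bij_betw_def by (blast intro: inj_on_subset)
qed

text \<open>By Krein-Milman, \<open>T\<close> is the hull of finitely many points. A symmetry of a
  polygon must be an isometry of the whole plane, so \<open>tr\<close> provides orthogonal maps
  rather than maps on \<open>T\<close>; conjugation with the linear isometry \<open>J\<close>
  carries them to \<open>real^2\<close>.\<close>

lemma affine_isomorphic_symmetric_polygon:
  fixes T :: "complex set"
  assumes T: "compact T" "convex T" "aff_dim T = 2" and fin: "finite (extreme_points T)"
    and tr: "\<And>u v. u \<in> extreme_points T \<Longrightarrow> v \<in> extreme_points T \<Longrightarrow>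
      \<exists>G. orthogonal_transformation G \<and> G ` T = T \<and> G u = v"
  shows "\<exists>P. symmetric_convex_polygon P \<and> affine_isomorphic T P"
proof -
  have "DIM(complex) = DIM(real^2)" by simp
  then obtain J :: "complex \<Rightarrow> real^2" and K where J: "linear J" "linear K" "\<And>x. norm (J x) = norm x"
    "\<And>y. norm (K y) = norm y" "\<And>x. K (J x) = x" "\<And>y. J (K y) = y"
    by (rule isomorphisms_UNIV_UNIV) (rule that, assumption, assumption, blast+)
  have injJ: "inj J" by (metis J(5) injI)
  let ?P = "J ` T"
  have aff: "affine_map_on T J" using affine_map_on_linear[OF J(1), of T 0 0] by simp
  have bij: "bij_betw J T ?P" using injJ by (auto simp: bij_betw_def intro: inj_on_subset)
  have ext: "extreme_points ?P = J ` extreme_points T"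
    using bij_betw_extreme_points[OF aff bij T(2)] by (simp add: bij_betw_def)
  have "T = convex hull (extreme_points T)"
    unfolding extreme_points_def by (rule Krein_Milman_Minkowski[OF T(1,2)])
  then have "polytope T" using fin polytope_def by blast
  then have "polytope ?P" by (rule polytope_linear_image[OF J(1)])
  moreover have "acts_transitively_on (affine_isometry_group ?P) (extreme_points ?P)"
  proof (subst acts_transitively_affine_isometry_group)
    show "convex ?P" by (rule convex_linear_image[OF J(1) T(2)])
    show "\<forall>x\<in>extreme_points ?P. \<forall>y\<in>extreme_points ?P. \<exists>f. affine_map_on UNIV f \<and> bij f \<and>
        (\<forall>x y. dist (f x) (f y) = dist x y) \<and> f ` ?P = ?P \<and> f x = y"
    proof (intro ballI)
      fix x y assume "x \<in> extreme_points ?P" "y \<in> extreme_points ?P"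
      then obtain u v where uv: "u \<in> extreme_points T" "v \<in> extreme_points T" "x = J u" "y = J v"
        unfolding ext by blast
      obtain G where G: "orthogonal_transformation G" "G ` T = T" "G u = v"
        using tr[OF uv(1,2)] by blast
      let ?f = "J \<circ> (G \<circ> K)"
      have lin: "linear ?f"
        using G(1) J(1,2) by (intro linear_compose) (auto simp: orthogonal_transformation)
      have nf: "norm (?f x) = norm x" for x
        using G(1) J(3,4) by (simp add: orthogonal_transformation)
      have "orthogonal_transformation ?f" using lin nf by (simp add: orthogonal_transformation)
      then have "bij ?f" by (rule orthogonal_transformation_bij)
      moreover have "affine_map_on UNIV ?f" using affine_map_on_linear[OF lin, of UNIV 0 0] by (simp add: o_def)
      moreover have "dist (?f x) (?f y) = dist x y" for x y
        using nf[of "x - y"] lin by (simp add: dist_norm linear_diff[OF lin, symmetric] del: o_apply)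
      moreover have "?f ` ?P = ?P"
      proof -
        have "?f ` ?P = J ` G ` T" by (simp add: image_image J(5))
        then show ?thesis by (simp add: G(2))
      qed
      moreover have "?f x = y" by (simp add: uv J(5) G(3))
      ultimately show "\<exists>f. affine_map_on UNIV f \<and> bij f \<and>
        (\<forall>x y. dist (f x) (f y) = dist x y) \<and> f ` ?P = ?P \<and> f x = y" by blast
    qed
  qed
  moreover have "aff_dim ?P = 2" using aff_dim_injective_linear_image[OF J(1) injJ] T(3) by simp
  moreover have "affine_isomorphic T ?P" using aff bij by (auto simp: affine_isomorphic_def)
  ultimately show ?thesis by (auto simp: symmetric_convex_polygon_def vertex_transitive_polytope_def)
qed

text \<open>Every point of the disk lies on a diameter, whose two ends belong to the circle.\<close>

lemma cball_subset_convex: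
  fixes T :: "complex set"
  assumes "convex T" "sphere 0 r \<subseteq> T" "r > 0"
  shows "cball 0 r \<subseteq> T"
proof
  fix p :: complex assume "p \<in> cball 0 r"
  \<comment> \<open>For \<open>p = 0\<close> the direction is arbitrary: any point \<open>q\<close>
    of the circle serves, because then \<open>t = 0\<close>.\<close>
  define q where "q = of_real r * cis (Arg2pi p)"
  define t where "t = norm p / r"
  have t: "0 \<le> t" "t \<le> 1" using \<open>p \<in> cball 0 r\<close> assms(3) by (auto simp: t_def)
  have "q \<in> T" "- q \<in> T" using assms(2,3) by (auto simp: q_def norm_mult subset_iff)
  then have "((1 + t) / 2) *\<^sub>R q + ((1 - t) / 2) *\<^sub>R (- q) \<in> T"
    using t by (intro convexD[OF assms(1)]) (auto simp: field_simps)
  also have "((1 + t) / 2) *\<^sub>R q + ((1 - t) / 2) *\<^sub>R (- q) = t *\<^sub>R q"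
    by (simp add: scaleR_left_distrib[symmetric] scaleR_left_diff_distrib[symmetric] flip: scaleR_minus_left) (simp add: field_simps)
  also have "t *\<^sub>R q = of_real (norm p) * cis (Arg2pi p)"
    using assms(3) by (simp add: t_def q_def scaleR_conv_of_real)
  also have "\<dots> = p" using Arg2pi_eq[of p] by (auto simp: cis_conv_exp)
  finally show "p \<in> T" .
qed

section \<open>Reduction to the plane and the two directions\<close>

text \<open>Translated by one of its points, \<open>S\<close> spans a 2-dimensional subspace, which
  is isometric to \<open>real^2\<close>. There the image has full dimension, so its interior equals
  its relative interior, which is nonempty for a nonempty convex set.\<close>

lemma affine_isomorphic_plane:
  fixes S :: "'a::euclidean_space set"
  assumes S: "compact S" "convex S" "aff_dim S = 2"
  obtains S' :: "(real^2) set" where "affine_isomorphic S S'" "compact S'" "convex S'" "interior S' \<noteq> {}"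
proof -
  have "S \<noteq> {}" using S(3) by auto
  then obtain a where a: "a \<in> S" by blast
  let ?S0 = "(\<lambda>x. x - a) ` S"
  have dim0: "dim ?S0 = 2"
    using aff_dim_eq_dim_subtract[of a S] a S(3) by (simp add: hull_inc)
  then have "dim (span ?S0) = dim (UNIV :: (real^2) set)" by simp
  then obtain f :: "'a \<Rightarrow> real^2" where f: "linear f" "\<And>x. x \<in> span ?S0 \<Longrightarrow> norm (f x) = norm x"
    by (rule isometry_subspaces[OF subspace_span subspace_UNIV]) (rule that, assumption, blast)
  have inj: "inj_on f (span ?S0)"
  proof (rule inj_onI)
    fix x y assume "x \<in> span ?S0" "y \<in> span ?S0" "f x = f y"
    then have "norm (x - y) = 0"
      using f(2)[of "x - y"] by (simp add: span_diff linear_diff[OF f(1)])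
    then show "x = y" by simp
  qed
  then have inj0: "inj_on f ?S0" by (rule inj_on_subset) (rule span_superset)
  define S' where "S' = f ` ?S0"
  have eq: "S' = (\<lambda>x. f (x - a) + 0) ` S" by (auto simp: S'_def)
  show ?thesis
  proof
    show "affine_isomorphic S S'"
      unfolding eq by (rule affine_isomorphic_linear[OF f(1)]) (rule inj0)
    show "compact S'" unfolding S'_def
      by (rule compact_continuous_image[OF linear_continuous_on])
         (use S(1) f(1) in \<open>simp_all add: linear_conv_bounded_linear compact_translation_subtract\<close>)
    show "convex S'" unfolding S'_def
      by (rule convex_linear_image[OF f(1)]) (use S(2) in \<open>simp add: convex_translation_subtract\<close>)
    have "0 \<in> S'" unfolding S'_def using a f(1) by (force simp: linear_0)
    then have "aff_dim S' = int (dim S')" by (simp add: aff_dim_zero hull_inc)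
    also have "dim S' = 2" unfolding S'_def using dim_image_eq[OF f(1) inj] dim0 by simp
    finally have "rel_interior S' = interior S'" by (intro interior_rel_interior) simp
    then show "interior S' \<noteq> {}"
      using rel_interior_eq_empty[OF \<open>convex S'\<close>] \<open>0 \<in> S'\<close> by auto
  qed
qed

lemma affine_transitive_imp_polygon_or_disk:
  fixes S :: "'a::euclidean_space set"
  assumes S: "compact S" "convex S" "aff_dim S = 2" and tr: "affine_transitive S"
  shows "(\<exists>P. symmetric_convex_polygon P \<and> affine_isomorphic S P) \<or> affine_isomorphic S unit_disk"
proof -
  obtain S' :: "(real^2) set" where S': "affine_isomorphic S S'" "compact S'" "convex S'" "interior S' \<noteq> {}"
    using affine_isomorphic_plane[OF S] .
  obtain T :: "complex set" where T: "affine_isomorphic S' T" "compact T" "convex T" "aff_dim T = 2"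
    and orth: "\<And>g. affine_map_on T g \<Longrightarrow> bij_betw g T T \<Longrightarrow> \<exists>G. orthogonal_transformation G \<and> (\<forall>x\<in>T. g x = G x)"
    using orthogonal_model[OF S'(2,3,4)] by metis
  have iso: "affine_isomorphic S T" by (rule affine_isomorphic_trans[OF S'(1) T(1)])
  let ?E = "extreme_points T"
  have trT: "affine_transitive T" by (rule affine_transitive_isomorphic[OF iso S(2) tr])
  have sub: "?E \<subseteq> T" by (auto simp: extreme_points_def extreme_point_of_def)
  have G: "\<exists>G. orthogonal_transformation G \<and> G ` T = T \<and> G ` ?E \<subseteq> ?E \<and> G u = v"
    if uv: "u \<in> ?E" "v \<in> ?E" for u v
  proof -
    obtain g where g: "affine_map_on T g" "bij_betw g T T" "g u = v"
      using trT uv unfolding affine_transitive_def by blast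
    obtain G where G: "orthogonal_transformation G" "\<forall>x\<in>T. g x = G x"
      using orth[OF g(1,2)] by blast
    have "bij_betw g ?E ?E" by (rule bij_betw_extreme_points[OF g(1,2) T(3)])
    then have "G ` ?E \<subseteq> ?E" using G(2) sub by (force simp: bij_betw_def)
    moreover have "G ` T = T" using g(2) G(2) by (force simp: bij_betw_def)
    moreover have "G u = v" using g(3) G(2) uv(1) sub by auto
    ultimately show ?thesis using G(1) by blast
  qed
  show ?thesis
  proof (cases "finite ?E")
    case True
    have "\<exists>P. symmetric_convex_polygon P \<and> affine_isomorphic T P"
      using G by (intro affine_isomorphic_symmetric_polygon[OF T(2,3,4) True]) blast
    then show ?thesis using affine_isomorphic_trans[OF iso] by blast
  next
    case False
    then obtain u where u: "u \<in> ?E" by fastforce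
    define r where "r = norm u"
    have sph: "?E \<subseteq> sphere 0 r"
    proof
      fix v assume "v \<in> ?E"
      then obtain G' where "orthogonal_transformation G'" "G' u = v" using G[OF u] by blast
      then show "v \<in> sphere 0 r" by (auto simp: r_def orthogonal_transformation)
    qed
    have r: "r > 0"
    proof (rule ccontr)
      assume "\<not> r > 0"
      then have "sphere 0 r \<subseteq> {0::complex}" by auto
      with sph False show False by (meson finite.emptyI finite_insert finite_subset)
    qed
    \<comment> \<open>Density suffices: \<open>T\<close> is closed and therefore contains the
      circle, and by convexity the disk. The reverse inclusion holds because \<open>T\<close> is the
      hull of its extreme points.\<close>
    have "sphere 0 r \<subseteq> closure ?E"
      by (rule infinite_orbit_dense[OF False sph r]) (use G in blast)
    also have "\<dots> \<subseteq> T" using sub T(2) by (simp add: closure_minimal compact_imp_closed)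
    finally have "cball 0 r \<subseteq> T" using T(3) r by (intro cball_subset_convex)
    moreover have "T \<subseteq> cball 0 r"
    proof -
      have "T = convex hull ?E"
        unfolding extreme_points_def by (rule Krein_Milman_Minkowski[OF T(2,3)])
      also have "\<dots> \<subseteq> cball 0 r" using sph by (intro hull_minimal) (auto simp: subset_iff)
      finally show ?thesis .
    qed
    ultimately have "T = cball 0 r" by blast
    then show ?thesis using affine_isomorphic_trans[OF iso] affine_isomorphic_cball_unit_disk[OF r] by blast
  qed
qed

lemma symmetric_convex_polygon_affine_transitive:
  assumes "symmetric_convex_polygon P"
  shows "affine_transitive P"
  unfolding affine_transitive_def
proof (intro ballI)
  fix x y assume xy: "x \<in> extreme_points P" "y \<in> extreme_points P"
  have P: "convex P" "acts_transitively_on (affine_isometry_group P) (extreme_points P)"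
    using assms by (auto simp: symmetric_convex_polygon_def vertex_transitive_polytope_def polytope_imp_convex)
  obtain f where f: "affine_map_on UNIV f" "bij f" "f ` P = P" "f x = y"
    using P(2) xy unfolding acts_transitively_affine_isometry_group[OF P(1)] by blast
  have "affine_map_on P f" using f(1) by (rule affine_map_on_subset) simp
  moreover have "bij_betw f P P" using f(2,3) by (auto simp: bij_betw_def intro: inj_on_subset)
  ultimately show "\<exists>f. affine_map_on P f \<and> bij_betw f P P \<and> f x = y" using f(4) by blast
qed

theorem theorem1:
  fixes S :: "'a::euclidean_space set"
  assumes "compact S" and "convex S" and "aff_dim S = 2"
  shows "acts_transitively_on (affine_aut_group S) (extreme_points S) \<longleftrightarrow>
           (\<exists>P. symmetric_convex_polygon P \<and> affine_isomorphic S P) \<or>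
           affine_isomorphic S unit_disk"
  unfolding acts_transitively_affine_aut_group[OF assms(2)]
proof
  assume "affine_transitive S"
  then show "(\<exists>P. symmetric_convex_polygon P \<and> affine_isomorphic S P) \<or> affine_isomorphic S unit_disk"
    by (rule affine_transitive_imp_polygon_or_disk[OF assms])
next
  assume "(\<exists>P. symmetric_convex_polygon P \<and> affine_isomorphic S P) \<or> affine_isomorphic S unit_disk"
  moreover have "convex P" if "symmetric_convex_polygon P" for P
    using that by (simp add: symmetric_convex_polygon_def vertex_transitive_polytope_def polytope_imp_convex)
  moreover have "convex unit_disk" by (simp add: unit_disk_eq_cball)
  \<comment> \<open>Both alternatives supply the same thing, a convex model with transitive
    automorphisms, so one transport argument treats them together.\<close>
  ultimately obtain P :: "(real^2) set" where P: "affine_transitive P" "convex P" "affine_isomorphic S P"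
    using symmetric_convex_polygon_affine_transitive affine_transitive_unit_disk by blast
  show "affine_transitive S"
    using affine_transitive_isomorphic[OF affine_isomorphic_sym[OF P(3) assms(2)] P(2,1)] .
qed

end
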